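(* Let $G$ be a finite simple cubic graph and let $H$ be its hexagon graph. Then $G$ has a directed cycle double cover if and only if $H$ admits a safe perfect matching.
   Context: **Directed cycle double cover.** A directed cycle double cover of $G$ is a family of cycles of $G$ together with a prescribed orientation of each cycle of the family such that each edge $e$ of $G$ belongs to exactly two cycles of the family and these two cycles induce opposite orientations on $e$. **Hexagon graph.** Let $G$ be a finite simple cubic graph with vertex set $V$ and edge set $E$. A hexagon graph $H$ of $G$ is built as follows. (1) Each $v\in V$ is replaced by a copy $h_v$ of $K_{3,3}$ (a "hexagon"), the $h_v$ being pairwise vertex disjoint, with $V(H)=\bigcup_{v\in V}V(h_v)$. (2) For each $v$, write $V(h_v)=\{v_i: i\in\mathbb{Z}_6\}$ and $E(h_v)=\{v_iv_{i+1},\,v_iv_{i+3}: i\in\mathbb{Z}_6\}$. To each neighbour $u$ of $v$ in $G$ assign an index $i_{v(u)}\in\{0,1,2\}\subset\mathbb{Z}_6$ so that the three neighbours of $v$ get pairwise distinct indices. (3) Let $X=\bigcup_{v\in V}\{v_0,v_2,v_4\}$ and $Y=\bigcup_{v\in V}\{v_1,v_3,v_5\}$. Each edge $uv\in E$ is replaced by two vertex disjoint edges $e_{uv},e'_{uv}$: if $v_{i_{v(u)}}$ and $u_{i_{u(v)}}$ both belong to $X$ or both belong to $Y$, then $e_{uv}=v_{i_{v(u)}}u_{i_{u(v)}+3}$ and $e'_{uv}=v_{i_{v(u)}+3}u_{i_{u(v)}}$; otherwise $e_{uv}=v_{i_{v(u)}}u_{i_{u(v)}}$ and $e'_{uv}=v_{i_{v(u)}+3}u_{i_{u(v)}+3}$.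 Finally $E(H)=\bigcup_{v\in V}E(h_v)\cup\{e_{uv},e'_{uv}:uv\in E\}$. All hexagon graphs of $G$ are isomorphic, so one speaks of the hexagon graph of $G$. **Colours and safe matchings.** Edges $v_iv_{i+3}$ are red, edges $v_iv_{i+1}$ are blue, and edges $e_{uv},e'_{uv}$ are white. The set $W$ of white edges is a perfect matching of $H$. A blue perfect matching is a perfect matching of $H$ containing only blue edges; for such $M$, $M\Delta W=M\cup W$ is a disjoint union of cycles. A safe perfect matching is a blue perfect matching $M$ such that no cycle of $M\Delta W$ contains both end vertices of a red edge. *)

theory Defs imports Main begin

definition simple_graph :: "'a set \<Rightarrow> 'a set set \<Rightarrow> bool" where
  "simple_graph V E \<longleftrightarrow> (\<forall>e\<in>E. e \<subseteq> V \<and> card e = 2)"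

definition neighbours :: "'a set set \<Rightarrow> 'a \<Rightarrow> 'a set" where
  "neighbours E v = {u. {v, u} \<in> E}"

definition finite_simple_cubic_graph :: "'a set \<Rightarrow> 'a set set \<Rightarrow> bool" where
  "finite_simple_cubic_graph V E \<longleftrightarrow>
     finite V \<and> simple_graph V E \<and> (\<forall>v\<in>V. card (neighbours E v) = 3)"

definition perfect_matching :: "'a set \<Rightarrow> 'a set set \<Rightarrow> 'a set set \<Rightarrow> bool" where
  "perfect_matching V E M \<longleftrightarrow> M \<subseteq> E \<and> (\<forall>v\<in>V. \<exists>!e. e \<in> M \<and> v \<in> e)"

(* A vertex list, read cyclically, represents a cycle together with one of its two orientations. *)

definition cycle_arcs :: "'a list \<Rightarrow> ('a \<times> 'a) set" where
  "cycle_arcs c = {(c ! i, c ! (Suc i mod length c)) | i. i < length c}"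

definition cycle_edges :: "'a list \<Rightarrow> 'a set set" where
  "cycle_edges c = {{u, v} | u v. (u, v) \<in> cycle_arcs c}"

definition is_cycle :: "'a set set \<Rightarrow> 'a list \<Rightarrow> bool" where
  "is_cycle E c \<longleftrightarrow> 3 \<le> length c \<and> distinct c \<and> cycle_edges c \<subseteq> E"

(* The family is a list, so a cycle may occur in it more than once. Members are told apart by
   their position. *)

definition directed_cycle_double_cover :: "'a set set \<Rightarrow> 'a list list \<Rightarrow> bool" where
  "directed_cycle_double_cover E cs \<longleftrightarrow>
     (\<forall>c\<in>set cs. is_cycle E c) \<and>
     (\<forall>e\<in>E. \<exists>i j. i \<noteq> j \<and> {k. k < length cs \<and> e \<in> cycle_edges (cs ! k)} = {i, j} \<and>
        (\<exists>u v. e = {u, v} \<and> (u, v) \<in> cycle_arcs (cs ! i) \<and> (v, u) \<in> cycle_arcs (cs ! j)))"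

(* The vertex v_i of the hexagon h_v is the pair (v, i); elements of Z_6 are the naturals below 6,
   with addition modulo 6. The index i_{v(u)} is idx v u; its values at pairs of non-adjacent
   vertices are irrelevant. *)

definition hexagon_indexing :: "'a set \<Rightarrow> 'a set set \<Rightarrow> ('a \<Rightarrow> 'a \<Rightarrow> nat) \<Rightarrow> bool" where
  "hexagon_indexing V E idx \<longleftrightarrow>
     (\<forall>v\<in>V. idx v ` neighbours E v \<subseteq> {0, 1, 2} \<and> inj_on (idx v) (neighbours E v))"

definition hex_verts :: "'a set \<Rightarrow> ('a \<times> nat) set" where
  "hex_verts V = V \<times> {..<6}"

definition hex_X :: "'a set \<Rightarrow> ('a \<times> nat) set" where
  "hex_X V = V \<times> {0, 2, 4}"

definition hex_Y :: "'a set \<Rightarrow> ('a \<times> nat) set" where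
  "hex_Y V = V \<times> {1, 3, 5}"

definition red_edges :: "'a set \<Rightarrow> ('a \<times> nat) set set" where
  "red_edges V = {{(v, i), (v, (i + 3) mod 6)} | v i. v \<in> V \<and> i < 6}"

definition blue_edges :: "'a set \<Rightarrow> ('a \<times> nat) set set" where
  "blue_edges V = {{(v, i), (v, (i + 1) mod 6)} | v i. v \<in> V \<and> i < 6}"

(* The two edges replacing uv. Indices are at most 2, so adding 3 needs no reduction modulo 6. *)

definition white_pair ::
  "'a set \<Rightarrow> ('a \<Rightarrow> 'a \<Rightarrow> nat) \<Rightarrow> 'a \<Rightarrow> 'a \<Rightarrow> ('a \<times> nat) set set" where
  "white_pair V idx u v =
     (let i = idx v u; j = idx u v in
      if {(v, i), (u, j)} \<subseteq> hex_X V \<or> {(v, i), (u, j)} \<subseteq> hex_Y V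
      then {{(v, i), (u, j + 3)}, {(v, i + 3), (u, j)}}
      else {{(v, i), (u, j)}, {(v, i + 3), (u, j + 3)}})"

definition white_edges ::
  "'a set \<Rightarrow> 'a set set \<Rightarrow> ('a \<Rightarrow> 'a \<Rightarrow> nat) \<Rightarrow> ('a \<times> nat) set set" where
  "white_edges V E idx = \<Union>{white_pair V idx u v | u v. {u, v} \<in> E}"

definition hex_edges ::
  "'a set \<Rightarrow> 'a set set \<Rightarrow> ('a \<Rightarrow> 'a \<Rightarrow> nat) \<Rightarrow> ('a \<times> nat) set set" where
  "hex_edges V E idx = red_edges V \<union> blue_edges V \<union> white_edges V E idx"

definition blue_perfect_matching ::
  "'a set \<Rightarrow> 'a set set \<Rightarrow> ('a \<Rightarrow> 'a \<Rightarrow> nat) \<Rightarrow> ('a \<times> nat) set set \<Rightarrow> bool" where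
  "blue_perfect_matching V E idx M \<longleftrightarrow>
     perfect_matching (hex_verts V) (hex_edges V E idx) M \<and> M \<subseteq> blue_edges V"

definition safe_perfect_matching ::
  "'a set \<Rightarrow> 'a set set \<Rightarrow> ('a \<Rightarrow> 'a \<Rightarrow> nat) \<Rightarrow> ('a \<times> nat) set set \<Rightarrow> bool" where
  "safe_perfect_matching V E idx M \<longleftrightarrow>
     blue_perfect_matching V E idx M \<and>
     \<not> (\<exists>c. is_cycle (sym_diff M (white_edges V E idx)) c \<and>
            (\<exists>r\<in>red_edges V. r \<subseteq> set c))"

lemma hexagon_indexing_exists:
  assumes "finite_simple_cubic_graph V E"
  shows "\<exists>idx. hexagon_indexing V E idx"
proof -
  have "\<exists>f. f ` neighbours E v \<subseteq> {0, 1, 2 :: nat} \<and> inj_on f (neighbours E v)" if "v \<in> V" for v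
  proof -
    have card: "card (neighbours E v) = 3"
      using assms that by (simp add: finite_simple_cubic_graph_def)
    then have "finite (neighbours E v)"
      by (simp add: card_ge_0_finite)
    then have "\<exists>f. bij_betw f (neighbours E v) {0, 1, 2 :: nat}"
      using card by (intro finite_same_card_bij) simp_all
    then obtain f where f: "bij_betw f (neighbours E v) {0, 1, 2 :: nat}" ..
    show ?thesis
      using bij_betw_imp_surj_on[OF f] bij_betw_imp_inj_on[OF f] by (intro exI[of _ f]) simp
  qed
  then have "\<forall>v\<in>V. \<exists>f. f ` neighbours E v \<subseteq> {0, 1, 2 :: nat} \<and> inj_on f (neighbours E v)"
    by (intro ballI)
  then have "\<exists>idx. \<forall>v\<in>V. idx v ` neighbours E v \<subseteq> {0, 1, 2 :: nat} \<and> inj_on (idx v) (neighbours E v)"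
    by (rule bchoice)
  then show ?thesis
    by (simp only: hexagon_indexing_def)
qed

end

theory Submission
  imports Defs "HOL-Combinatorics.Cycles"
begin

text \<open>A blue perfect matching chooses, at every vertex \<open>v\<close> of \<open>G\<close>, one of the two cyclic orders of
  the neighbours of \<open>v\<close>, so blue perfect matchings are the rotation systems of \<open>G\<close> and the cycles
  of \<open>M \<Delta> W\<close> are the facial walks. The two ends of a red edge stand for the two opposite arcs of
  an edge of \<open>G\<close>; hence \<open>M\<close> is safe if and only if no facial walk uses an edge in both directions.
  As \<open>G\<close> is cubic, such a facial walk visits no vertex twice: two of the three transitions at a vertex
  always involve opposite arcs of one edge. So the faces are directed cycles and form a double cover.
  Conversely, the successor relation of a directed cycle double cover is a rotation system, and its
  facial walks are the cycles of the cover.\<close>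

section \<open>Arcs of cyclic lists\<close>

lemma cycle_arcs_image:
  "cycle_arcs c = (\<lambda>i. (c ! i, c ! (Suc i mod length c))) ` {..<length c}"
  by (auto simp: cycle_arcs_def)

lemma cycle_arcs_map: "cycle_arcs (map f c) = map_prod f f ` cycle_arcs c"
proof -
  have "map f c ! (Suc i mod length c) = f (c ! (Suc i mod length c))" if "i < length c" for i
    using that by (intro nth_map mod_less_divisor) auto
  then show ?thesis
    by (simp add: cycle_arcs_image image_image)
qed

text \<open>\<open>support p x\<close> lists the orbit of \<open>x\<close> up to the least positive
  power of \<open>p\<close> fixing \<open>x\<close>, so the arc closing the list is an application
  of \<open>p\<close> like all the others.\<close>

lemma cycle_arcs_support:
  assumes "permutation p"
  shows "cycle_arcs (support p x) = (\<lambda>y. (y, p y)) ` set (support p x)"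
proof -
  let ?n = "least_power p x"
  have n: "?n > 0" "(p ^^ ?n) x = x"
    using least_power_of_permutation[OF assms] by auto
  have step: "(p ^^ (Suc i mod ?n)) x = p ((p ^^ i) x)" if "i < ?n" for i
  proof (cases "Suc i = ?n")
    case True
    then have "p ((p ^^ i) x) = x"
      using n(2) by (metis comp_apply funpow.simps(2))
    then show ?thesis using n True that by simp
  qed (use that in simp)
  have "cycle_arcs (support p x) = (\<lambda>i. ((p ^^ i) x, p ((p ^^ i) x))) ` {..<?n}"
    unfolding cycle_arcs_image by (intro image_cong) (simp_all add: step)
  also have "\<dots> = (\<lambda>y. (y, p y)) ` set (support p x)"
    by (simp add: image_image atLeast0LessThan)
  finally show ?thesis .
qed

lemma cycle_arcs_set:
  assumes "(u, v) \<in> cycle_arcs c"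
  shows "u \<in> set c" "v \<in> set c"
  using assms by (auto simp: cycle_arcs_def intro!: nth_mem mod_less_divisor)

lemma cycle_arcs_edge: "is_cycle E c \<Longrightarrow> (u, v) \<in> cycle_arcs c \<Longrightarrow> {u, v} \<in> E"
  by (auto simp: is_cycle_def cycle_edges_def)

lemma Suc_mod_inj:
  assumes "i < n" "j < n" "Suc i mod n = Suc j mod n"
  shows "i = j"
  using assms by (auto simp: mod_Suc split: if_splits)

lemma cycle_arcs_fst_unique:
  assumes "distinct c" "(u, w) \<in> cycle_arcs c" "(u, w') \<in> cycle_arcs c"
  shows "w = w'"
  using assms by (auto simp: cycle_arcs_def nth_eq_iff_index_eq)

lemma cycle_arcs_snd_unique:
  assumes "distinct c" "(u, w) \<in> cycle_arcs c" "(u', w) \<in> cycle_arcs c"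
  shows "u = u'"
proof -
  obtain i j where ij: "i < length c" "u = c ! i" "w = c ! (Suc i mod length c)"
    "j < length c" "u' = c ! j" "w = c ! (Suc j mod length c)"
    using assms(2,3) by (auto simp: cycle_arcs_def)
  moreover have "Suc i mod length c < length c" "Suc j mod length c < length c"
    using ij by (auto intro!: mod_less_divisor)
  ultimately have "Suc i mod length c = Suc j mod length c"
    using assms(1) by (metis nth_eq_iff_index_eq)
  then show ?thesis using ij Suc_mod_inj by metis
qed

text \<open>In a list of length at least 3, positions two apart are distinct also cyclically, so a
  cycle never turns back.\<close>

lemma is_cycle_succ:
  assumes "is_cycle E c" "(u, v) \<in> cycle_arcs c"
  shows "\<exists>w. (v, w) \<in> cycle_arcs c \<and> w \<noteq> u"
proof -
  have len: "3 \<le> length c" and dist: "distinct c"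
    using assms(1) by (auto simp: is_cycle_def)
  obtain i where i: "i < length c" "u = c ! i" "v = c ! (Suc i mod length c)"
    using assms(2) by (auto simp: cycle_arcs_def)
  let ?j = "Suc i mod length c" and ?k = "Suc (Suc i mod length c) mod length c"
  have lt: "?j < length c" "?k < length c"
    using i by (auto intro!: mod_less_divisor)
  have "?k \<noteq> i"
    using len i(1) by (auto simp: mod_Suc split: if_splits)
  then have "c ! ?k \<noteq> u"
    using dist i lt by (simp add: nth_eq_iff_index_eq)
  moreover have "(v, c ! ?k) \<in> cycle_arcs c"
    using i lt unfolding cycle_arcs_def by blast
  ultimately show ?thesis by blast
qed

text \<open>The successor of \<open>v\<close> is unique and differs from \<open>u\<close>.\<close>

lemma is_cycle_arc_antisym:
  assumes "is_cycle E c" "(u, v) \<in> cycle_arcs c"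
  shows "(v, u) \<notin> cycle_arcs c"
proof
  assume vu: "(v, u) \<in> cycle_arcs c"
  obtain w where "(v, w) \<in> cycle_arcs c" "w \<noteq> u"
    using is_cycle_succ[OF assms] by blast
  then show False
    using vu assms(1) cycle_arcs_fst_unique unfolding is_cycle_def by metis
qed

lemma cycle_edges_image: "cycle_edges c = (\<lambda>(u, v). {u, v}) ` cycle_arcs c"
  by (auto simp: cycle_edges_def)

lemma cycle_edges_iff:
  "{u, v} \<in> cycle_edges c \<longleftrightarrow> (u, v) \<in> cycle_arcs c \<or> (v, u) \<in> cycle_arcs c"
  by (auto simp: cycle_edges_def doubleton_eq_iff insert_commute)

text \<open>Equality of labels propagates from each position to the next. Safety is verified this
  way: vertices with different labels share no cycle.\<close>

lemma constant_on_cycle: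
  assumes step: "\<And>x y. {x, y} \<in> E \<Longrightarrow> f x = f y"
    and c: "is_cycle E c" and "x \<in> set c" "y \<in> set c"
  shows "f x = f y"
proof -
  have "f (c ! i) = f (c ! 0)" if "i < length c" for i
    using that
  proof (induction i)
    case (Suc i)
    then have "(c ! i, c ! Suc i) \<in> cycle_arcs c"
      unfolding cycle_arcs_def by (auto intro!: exI[of _ i])
    then show ?case
      using Suc step cycle_arcs_edge[OF c] by (metis Suc_lessD)
  qed simp
  then show ?thesis
    using assms(3,4) by (metis in_set_conv_nth)
qed

section \<open>Double covers as partitions of the arcs\<close>

text \<open>The two members through an edge traverse it in opposite directions, and neither contains
  both directions, so each arc selects exactly one of them.\<close>

lemma dcdc_arc_unique:
  assumes "directed_cycle_double_cover E cs" "{u, v} \<in> E"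
  shows "\<exists>!k. k < length cs \<and> (u, v) \<in> cycle_arcs (cs ! k)"
proof -
  have "\<exists>i j. i \<noteq> j \<and> {k. k < length cs \<and> {u, v} \<in> cycle_edges (cs ! k)} = {i, j} \<and>
      (\<exists>u' v'. {u, v} = {u', v'} \<and> (u', v') \<in> cycle_arcs (cs ! i) \<and> (v', u') \<in> cycle_arcs (cs ! j))"
    using assms(1)[unfolded directed_cycle_double_cover_def, THEN conjunct2] assms(2) by (rule bspec)
  then obtain i j u' v' where ij: "i \<noteq> j"
      "{k. k < length cs \<and> {u, v} \<in> cycle_edges (cs ! k)} = {i, j}"
    and e: "{u, v} = {u', v'}" "(u', v') \<in> cycle_arcs (cs ! i)" "(v', u') \<in> cycle_arcs (cs ! j)"
    by (elim exE conjE)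
  have lt: "i < length cs" "j < length cs" using ij(2) by auto
  then have "is_cycle E (cs ! i)" "is_cycle E (cs ! j)"
    using assms(1) by (auto simp: directed_cycle_double_cover_def)
  then have n: "(v', u') \<notin> cycle_arcs (cs ! i)" "(u', v') \<notin> cycle_arcs (cs ! j)"
    using e is_cycle_arc_antisym by metis+
  have mem: "k = i \<or> k = j" if "k < length cs" "(u, v) \<in> cycle_arcs (cs ! k)" for k
    using that ij(2) by (auto simp: cycle_edges_iff)
  from e(1) consider "u = u'" "v = v'" | "u = v'" "v = u'"
    by (auto simp: doubleton_eq_iff)
  then obtain k where k: "k < length cs" "(u, v) \<in> cycle_arcs (cs ! k)" "k \<in> {i, j}"
    "\<And>l. l \<in> {i, j} \<Longrightarrow> (u, v) \<in> cycle_arcs (cs ! l) \<Longrightarrow> l = k"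
    using e(2,3) n lt by cases blast+
  show ?thesis
    by (rule ex1I[of _ k]) (use k mem in blast)+
qed

text \<open>No cycle contains two opposite arcs, so the parts holding the two arcs of an edge are
  different; their positions in a repetition-free list of the parts serve as \<open>i\<close> and
  \<open>j\<close>.\<close>

lemma dcdc_from_arc_partition:
  assumes simple: "simple_graph V E"
    and P: "finite P" "disjoint P" "\<Union>P = {(u, v). {u, v} \<in> E}"
    and cyc: "\<And>A. A \<in> P \<Longrightarrow> \<exists>c. is_cycle E c \<and> cycle_arcs c = A"
  shows "\<exists>cs. directed_cycle_double_cover E cs"
proof -
  obtain L where L: "set L = P" "distinct L"
    using finite_distinct_list[OF P(1)] by blast
  obtain rep where rep: "\<And>A. A \<in> P \<Longrightarrow> is_cycle E (rep A) \<and> cycle_arcs (rep A) = A"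
    using cyc by metis
  let ?cs = "map rep L"
  have nth: "is_cycle E (?cs ! k)" "cycle_arcs (?cs ! k) = L ! k" if "k < length L" for k
    using rep[of "L ! k"] that L(1) by auto
  have arc: "\<exists>!k. k < length L \<and> (u, v) \<in> L ! k" if uv: "{u, v} \<in> E" for u v
  proof -
    have "(u, v) \<in> \<Union>(set L)"
      using uv P(3) L(1) by simp
    then obtain k where k: "k < length L" "(u, v) \<in> L ! k"
      by (auto simp: in_set_conv_nth)
    have "l = k" if "l < length L" "(u, v) \<in> L ! l" for l
    proof -
      have "L ! l = L ! k"
        using that k P(2) L(1) unfolding disjoint_def by (metis IntI empty_iff nth_mem)
      then show ?thesis
        using that k L(2) by (simp add: nth_eq_iff_index_eq)
    qed
    then show ?thesis using k by blast
  qed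
  have "\<exists>i j. i \<noteq> j \<and> {k. k < length ?cs \<and> e \<in> cycle_edges (?cs ! k)} = {i, j} \<and>
        (\<exists>u v. e = {u, v} \<and> (u, v) \<in> cycle_arcs (?cs ! i) \<and> (v, u) \<in> cycle_arcs (?cs ! j))"
    if e: "e \<in> E" for e
  proof -
    obtain u v where uv: "e = {u, v}"
      using simple e unfolding simple_graph_def by (meson card_2_iff)
    obtain i where i: "i < length L" "(u, v) \<in> L ! i"
        "\<And>k. k < length L \<Longrightarrow> (u, v) \<in> L ! k \<Longrightarrow> k = i"
      using arc[of u v] e uv by blast
    obtain j where j: "j < length L" "(v, u) \<in> L ! j"
        "\<And>k. k < length L \<Longrightarrow> (v, u) \<in> L ! k \<Longrightarrow> k = j"
      using arc[of v u] e uv by (auto simp: insert_commute)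
    have "(v, u) \<notin> L ! i"
      using is_cycle_arc_antisym[OF nth(1)[OF i(1)], of u v] i(2) unfolding nth(2)[OF i(1)] .
    then have "i \<noteq> j"
      using j(2) by blast
    moreover have "{k. k < length ?cs \<and> e \<in> cycle_edges (?cs ! k)} = {i, j}"
    proof -
      have "k < length ?cs \<and> e \<in> cycle_edges (?cs ! k) \<longleftrightarrow>
          k < length L \<and> ((u, v) \<in> L ! k \<or> (v, u) \<in> L ! k)" for k
        using nth(2)[of k] by (auto simp: uv cycle_edges_iff simp del: nth_map)
      then show ?thesis using i j by blast
    qed
    moreover have "(u, v) \<in> cycle_arcs (?cs ! i)" "(v, u) \<in> cycle_arcs (?cs ! j)"
      unfolding nth(2)[OF i(1)] nth(2)[OF j(1)] by (rule i(2), rule j(2))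
    ultimately show ?thesis
      using uv by (intro exI[of _ i] exI[of _ j] conjI exI[of _ u] exI[of _ v])
  qed
  then show ?thesis
    using nth(1) unfolding directed_cycle_double_cover_def
    by (intro exI[of _ ?cs] conjI ballI) (auto simp: in_set_conv_nth)
qed

section \<open>The hexagon graph described by ports\<close>

locale indexed_cubic_graph =
  fixes V :: "'a set" and E :: "'a set set" and idx :: "'a \<Rightarrow> 'a \<Rightarrow> nat"
  assumes cubic: "finite_simple_cubic_graph V E"
    and indexing: "hexagon_indexing V E idx"
begin

abbreviation "N \<equiv> neighbours E"

lemma edge_verts: "{u, v} \<in> E \<Longrightarrow> u \<in> V \<and> v \<in> V \<and> u \<noteq> v"
  using cubic unfolding finite_simple_cubic_graph_def simple_graph_def
  by (metis card_2_iff doubleton_eq_iff insert_subset)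

lemma in_N: "u \<in> N v \<longleftrightarrow> {v, u} \<in> E"
  by (simp add: neighbours_def)

lemma N_sym: "u \<in> N v \<longleftrightarrow> v \<in> N u"
  by (simp add: in_N insert_commute)

lemma N_verts: "u \<in> N v \<Longrightarrow> u \<in> V \<and> v \<in> V \<and> u \<noteq> v"
  using edge_verts by (auto simp: in_N)

lemma card_N: "v \<in> V \<Longrightarrow> card (N v) = 3"
  using cubic by (simp add: finite_simple_cubic_graph_def)

lemma finite_N: "v \<in> V \<Longrightarrow> finite (N v)"
  using card_N by (metis card.infinite zero_neq_numeral)

lemma idx_inj: "u \<in> N v \<Longrightarrow> w \<in> N v \<Longrightarrow> idx v u = idx v w \<longleftrightarrow> u = w"
  using indexing N_verts unfolding hexagon_indexing_def inj_on_def by metis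

lemma idx_cases:
  assumes "u \<in> N v"
  obtains "idx v u = 0" | "idx v u = 1" | "idx v u = 2"
proof -
  have "idx v u \<in> {0, 1, 2}"
    using indexing assms N_verts[OF assms] unfolding hexagon_indexing_def
    by (meson imageI subsetD)
  then show thesis
    using that by blast
qed

lemma idx_surj:
  assumes "v \<in> V" "i < 3"
  obtains u where "u \<in> N v" "idx v u = i"
proof -
  have "idx v ` N v \<subseteq> {0, 1, 2}" "inj_on (idx v) (N v)"
    using indexing assms by (auto simp: hexagon_indexing_def)
  then have "idx v ` N v = {0, 1, 2}"
    using card_N[OF assms(1)] by (intro card_subset_eq) (auto simp: card_image)
  moreover have "i \<in> {0, 1, 2}" using assms by auto
  ultimately show thesis using that by (metis imageE)
qed

text \<open>Every blue and every white edge joins \<open>X\<close> to \<open>Y\<close>. Directing white edges from \<open>X\<close> to \<open>Y\<close>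
  and blue ones from \<open>Y\<close> to \<open>X\<close>, an arc \<open>(v, u)\<close> of \<open>G\<close> leaves \<open>v\<close> through the vertex of \<open>X\<close>, and
  the arc \<open>(u, v)\<close> enters \<open>v\<close> through the vertex of \<open>Y\<close>, among the two vertices of \<open>h\<^sub>v\<close> that
  are assigned to \<open>u\<close>.\<close>

definition out_port :: "'a \<Rightarrow> 'a \<Rightarrow> 'a \<times> nat" where
  "out_port v u = (v, if even (idx v u) then idx v u else idx v u + 3)"

definition in_port :: "'a \<Rightarrow> 'a \<Rightarrow> 'a \<times> nat" where
  "in_port v u = (v, if even (idx v u) then idx v u + 3 else idx v u)"

lemma out_port_inj:
  assumes "u \<in> N v" "u' \<in> N v'"
  shows "out_port v u = out_port v' u' \<longleftrightarrow> v = v' \<and> u = u'"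
proof -
  have "v = v' \<and> idx v u = idx v u'" if "out_port v u = out_port v' u'"
    using that by (cases rule: idx_cases[OF assms(1)]; cases rule: idx_cases[OF assms(2)])
      (auto simp: out_port_def)
  then show ?thesis
    using assms idx_inj by metis
qed

lemma in_port_inj:
  assumes "u \<in> N v" "u' \<in> N v'"
  shows "in_port v u = in_port v' u' \<longleftrightarrow> v = v' \<and> u = u'"
proof -
  have "v = v' \<and> idx v u = idx v u'" if "in_port v u = in_port v' u'"
    using that by (cases rule: idx_cases[OF assms(1)]; cases rule: idx_cases[OF assms(2)])
      (auto simp: in_port_def)
  then show ?thesis
    using assms idx_inj by metis
qed

text \<open>Out ports have even position, in ports odd position.\<close>

lemma out_port_neq_in_port: "out_port v u \<noteq> in_port v' u'"
  by (auto simp: out_port_def in_port_def) presburger+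

lemma fst_port [simp]: "fst (out_port v u) = v" "fst (in_port v u) = v"
  by (simp_all add: out_port_def in_port_def)

text \<open>Position \<open>i\<close> is one of the two ports assigned to the neighbour of index
  \<open>i mod 3\<close>; the parity of \<open>i\<close> decides which.\<close>

lemma hex_verts_ports:
  "hex_verts V = (\<Union>v\<in>V. out_port v ` N v \<union> in_port v ` N v)"
proof (intro equalityI subsetI)
  fix x assume "x \<in> hex_verts V"
  then obtain v i where x: "x = (v, i)" "v \<in> V" "i < 6"
    by (auto simp: hex_verts_def)
  obtain u where u: "u \<in> N v" "idx v u = i mod 3"
    using idx_surj[OF x(2), of "i mod 3"] by auto
  have "i \<in> {0, 1, 2, 3, 4, 5}" using x(3) by auto
  then have "x = out_port v u \<or> x = in_port v u"
    using u x by (auto simp: out_port_def in_port_def)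
  then show "x \<in> (\<Union>v\<in>V. out_port v ` N v \<union> in_port v ` N v)"
    using u x by blast
next
  fix x assume "x \<in> (\<Union>v\<in>V. out_port v ` N v \<union> in_port v ` N v)"
  then obtain v u where vu: "v \<in> V" "u \<in> N v" "x = out_port v u \<or> x = in_port v u"
    by blast
  then show "x \<in> hex_verts V"
    by (cases rule: idx_cases[OF vu(2)]) (auto simp: hex_verts_def out_port_def in_port_def)
qed

text \<open>Adding 3 modulo 6 keeps the residue modulo 3 and flips the parity.\<close>

lemma red_edges_ports: "red_edges V = {{out_port v u, in_port v u} | v u. u \<in> N v}"
proof (intro equalityI subsetI)
  fix r assume "r \<in> red_edges V"
  then obtain v i where x: "r = {(v, i), (v, (i + 3) mod 6)}" "v \<in> V" "i < 6"
    by (auto simp: red_edges_def)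
  obtain u where u: "u \<in> N v" "idx v u = i mod 3"
    using idx_surj[OF x(2), of "i mod 3"] by auto
  have "i \<in> {0, 1, 2, 3, 4, 5}" using x(3) by auto
  then have "r = {out_port v u, in_port v u}"
    using u x by (auto simp: out_port_def in_port_def)
  then show "r \<in> {{out_port v u, in_port v u} | v u. u \<in> N v}"
    using u by blast
next
  fix r assume "r \<in> {{out_port v u, in_port v u} | v u. u \<in> N v}"
  then obtain v u where u: "u \<in> N v" "r = {out_port v u, in_port v u}"
    by blast
  then have "r = {(v, idx v u), (v, (idx v u + 3) mod 6)}" "idx v u < 6"
    by (cases rule: idx_cases[of u v]; auto simp: out_port_def in_port_def)+
  then show "r \<in> red_edges V"
    using N_verts[OF u(1)] unfolding red_edges_def by blast
qed

text \<open>The case distinction in \<open>white_pair\<close> shifts by 3 exactly so that both edges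
  join X to Y, that is, an out port to an in port.\<close>

lemma white_pair_ports:
  assumes "{u, v} \<in> E"
  shows "white_pair V idx u v = {{out_port u v, in_port v u}, {in_port u v, out_port v u}}"
proof -
  have N: "u \<in> N v" "v \<in> N u" "u \<in> V" "v \<in> V"
    using assms edge_verts by (auto simp: in_N insert_commute)
  show ?thesis
    by (cases rule: idx_cases[OF N(1)]; cases rule: idx_cases[OF N(2)])
      (use N in \<open>simp_all add: white_pair_def hex_X_def hex_Y_def out_port_def in_port_def
        insert_commute\<close>)
qed

text \<open>There is one white edge per arc: the second edge of the pair for \<open>(u, v)\<close>
  is the first edge of the pair for \<open>(v, u)\<close>.\<close>

lemma white_edges_ports: "white_edges V E idx = {{out_port u v, in_port v u} | u v. {u, v} \<in> E}"
proof -
  have "white_edges V E idx =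
      \<Union>{{{out_port u v, in_port v u}, {in_port u v, out_port v u}} | u v. {u, v} \<in> E}"
    unfolding white_edges_def using white_pair_ports by (metis (no_types, lifting))
  also have "\<dots> = {{out_port u v, in_port v u} | u v. {u, v} \<in> E}"
    by (auto simp: insert_commute) (metis insert_commute)+
  finally show ?thesis .
qed

text \<open>Consecutive positions differ in parity and in residue modulo 3. Conversely, an odd and
  an even position with different residues differ by 1 or -1 modulo 6.\<close>

lemma blue_edges_ports:
  "blue_edges V = {{in_port v u, out_port v w} | v u w. u \<in> N v \<and> w \<in> N v \<and> w \<noteq> u}"
proof (intro equalityI subsetI)
  fix b assume "b \<in> blue_edges V"
  then obtain v i where x: "b = {(v, i), (v, (i + 1) mod 6)}" "v \<in> V" "i < 6"
    by (auto simp: blue_edges_def)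
  obtain u where u: "u \<in> N v" "idx v u = i mod 3"
    using idx_surj[OF x(2), of "i mod 3"] by auto
  obtain w where w: "w \<in> N v" "idx v w = (i + 1) mod 3"
    using idx_surj[OF x(2), of "(i + 1) mod 3"] by auto
  have i: "i \<in> {0, 1, 2, 3, 4, 5}" using x(3) by auto
  have "w \<noteq> u" using u(2) w(2) by (auto simp: mod_Suc split: if_splits)
  moreover have "b = {in_port v u, out_port v w} \<or> b = {in_port v w, out_port v u}"
    using i u(2) w(2) x(1)
    by (elim insertE emptyE) (simp_all add: out_port_def in_port_def insert_commute)
  ultimately show "b \<in> {{in_port v u, out_port v w} | v u w. u \<in> N v \<and> w \<in> N v \<and> w \<noteq> u}"
    using u w by blast
next
  fix b assume "b \<in> {{in_port v u, out_port v w} | v u w. u \<in> N v \<and> w \<in> N v \<and> w \<noteq> u}"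
  then obtain v u w where b: "b = {in_port v u, out_port v w}" "u \<in> N v" "w \<in> N v" "w \<noteq> u"
    by blast
  have ne: "idx v w \<noteq> idx v u" using idx_inj b by blast
  have blue: "{(v, i), (v, j)} \<in> blue_edges V" if "i < 6" "j = (i + 1) mod 6" for i j
    using that N_verts[OF b(2)] unfolding blue_edges_def by blast
  \<comment> \<open>Equal indices are excluded by \<open>ne\<close>; in each remaining case one of
    the two ports is the cyclic successor of the other.\<close>
  show "b \<in> blue_edges V"
    unfolding b(1)
    by (cases rule: idx_cases[OF b(2)]; cases rule: idx_cases[OF b(3)];
      use ne in \<open>simp add: out_port_def in_port_def\<close>;
      ((rule blue; force) | (subst insert_commute; rule blue; force)))
qed

text \<open>Blue edges stay within one hexagon, white edges join two; the projection
  \<open>fst\<close> tells them apart.\<close>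

lemma blue_white_disjoint: "blue_edges V \<inter> white_edges V E idx = {}"
proof -
  have False if b: "b \<in> blue_edges V" "b \<in> white_edges V E idx" for b
  proof -
    obtain v where "fst ` b = {v}"
      using b(1) by (force simp: blue_edges_ports)
    moreover obtain u w where "fst ` b = {u, w}" "u \<noteq> w"
      using b(2) edge_verts by (force simp: white_edges_ports)
    ultimately show False by auto
  qed
  then show ?thesis by blast
qed

lemma sym_diff_blue_white:
  "M \<subseteq> blue_edges V \<Longrightarrow> sym_diff M (white_edges V E idx) = M \<union> white_edges V E idx"
  using blue_white_disjoint by blast

section \<open>Rotation systems and their matchings\<close>

text \<open>An injective self-map of three neighbours without fixed points is a 3-cycle, hence one
  of the two cyclic orders at \<open>v\<close>. Values off \<open>N v\<close> are left free.\<close>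

definition rotation :: "('a \<Rightarrow> 'a \<Rightarrow> 'a) \<Rightarrow> bool" where
  "rotation \<sigma> \<longleftrightarrow>
     (\<forall>v. inj_on (\<sigma> v) (N v) \<and> (\<forall>u\<in>N v. \<sigma> v u \<in> N v \<and> \<sigma> v u \<noteq> u))"

lemma rotation_inj: "rotation \<sigma> \<Longrightarrow> u \<in> N v \<Longrightarrow> w \<in> N v \<Longrightarrow> \<sigma> v u = \<sigma> v w \<Longrightarrow> u = w"
  unfolding rotation_def inj_on_def by blast

lemma rotation_N: "rotation \<sigma> \<Longrightarrow> u \<in> N v \<Longrightarrow> \<sigma> v u \<in> N v"
  unfolding rotation_def by blast

lemma rotation_neq: "rotation \<sigma> \<Longrightarrow> u \<in> N v \<Longrightarrow> \<sigma> v u \<noteq> u"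
  unfolding rotation_def by blast

lemma rotation_surj:
  assumes "rotation \<sigma>" "w \<in> N v"
  obtains u where "u \<in> N v" "\<sigma> v u = w"
proof -
  have "\<sigma> v ` N v = N v"
    using assms finite_N N_verts by (intro endo_inj_surj) (auto simp: rotation_def)
  then show thesis using assms(2) that by (metis imageE)
qed

text \<open>Otherwise \<open>a\<close>, \<open>b\<close> and their images would be four distinct
  neighbours of \<open>v\<close>. This use of degree three is what makes the faces simple
  cycles.\<close>

lemma rotation_adjacent:
  assumes "rotation \<sigma>" "a \<in> N v" "b \<in> N v" "a \<noteq> b"
  shows "\<sigma> v a = b \<or> \<sigma> v b = a"
proof (rule ccontr)
  assume no: "\<not> (\<sigma> v a = b \<or> \<sigma> v b = a)"
  have v: "v \<in> V" using assms N_verts by blast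
  have "\<sigma> v a \<noteq> a" "\<sigma> v b \<noteq> b" "\<sigma> v a \<noteq> \<sigma> v b" "\<sigma> v a \<in> N v" "\<sigma> v b \<in> N v"
    using assms rotation_inj rotation_neq rotation_N by metis+
  then have "card {a, b, \<sigma> v a, \<sigma> v b} = 4" "{a, b, \<sigma> v a, \<sigma> v b} \<subseteq> N v"
    using no assms by auto
  then have "4 \<le> card (N v)"
    using card_mono[OF finite_N[OF v], of "{a, b, \<sigma> v a, \<sigma> v b}"] by simp
  then show False
    using card_N[OF v] by simp
qed

text \<open>A walk that enters \<open>v\<close> from \<open>u\<close> leaves it towards
  \<open>\<sigma> v u\<close>.\<close>

definition rotation_matching :: "('a \<Rightarrow> 'a \<Rightarrow> 'a) \<Rightarrow> ('a \<times> nat) set set" where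
  "rotation_matching \<sigma> = {{in_port v u, out_port v (\<sigma> v u)} | v u. u \<in> N v}"

text \<open>Each in port starts one edge; each out port is reached because \<open>\<sigma> v\<close>
  is onto \<open>N v\<close>, and only once because it is injective.\<close>

lemma blue_perfect_matching_rotation_matching:
  assumes rot: "rotation \<sigma>"
  shows "blue_perfect_matching V E idx (rotation_matching \<sigma>)"
proof -
  let ?M = "rotation_matching \<sigma>"
  have blue: "?M \<subseteq> blue_edges V"
    unfolding rotation_matching_def blue_edges_ports
    using rotation_N[OF rot] rotation_neq[OF rot] by blast
  have "\<exists>!e. e \<in> ?M \<and> x \<in> e" if hex: "x \<in> hex_verts V" for x
  proof -
    obtain v w where vw: "w \<in> N v" "x = out_port v w \<or> x = in_port v w"
      using hex unfolding hex_verts_ports by blast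
    from vw(2) show ?thesis
    proof
      assume x: "x = out_port v w"
      obtain u where u: "u \<in> N v" "\<sigma> v u = w"
        using rotation_surj[OF rot vw(1)] .
      show ?thesis
      proof (rule ex1I[of _ "{in_port v u, out_port v w}"])
        show "{in_port v u, out_port v w} \<in> ?M \<and> x \<in> {in_port v u, out_port v w}"
          using u x unfolding rotation_matching_def by blast
        fix e assume e: "e \<in> ?M \<and> x \<in> e"
        then obtain v' u' where e': "u' \<in> N v'" "e = {in_port v' u', out_port v' (\<sigma> v' u')}"
          unfolding rotation_matching_def by blast
        then have "out_port v w = out_port v' (\<sigma> v' u')"
          using e x out_port_neq_in_port by auto
        then have "v = v'" "w = \<sigma> v' u'"
          using out_port_inj vw(1) e'(1) rotation_N[OF rot] by blast+
        then show "e = {in_port v u, out_port v w}"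
          using rotation_inj[OF rot] u e' by blast
      qed
    next
      assume x: "x = in_port v w"
      show ?thesis
      proof (rule ex1I[of _ "{in_port v w, out_port v (\<sigma> v w)}"])
        show "{in_port v w, out_port v (\<sigma> v w)} \<in> ?M \<and> x \<in> {in_port v w, out_port v (\<sigma> v w)}"
          using vw x unfolding rotation_matching_def by blast
        fix e assume e: "e \<in> ?M \<and> x \<in> e"
        then obtain v' u' where e': "u' \<in> N v'" "e = {in_port v' u', out_port v' (\<sigma> v' u')}"
          unfolding rotation_matching_def by blast
        then have "in_port v w = in_port v' u'"
          using e x out_port_neq_in_port[symmetric] by auto
        then show "e = {in_port v w, out_port v (\<sigma> v w)}"
          using in_port_inj vw(1) e' by blast
      qed
    qed
  qed
  then show ?thesis
    using blue unfolding blue_perfect_matching_def perfect_matching_def hex_edges_def by blast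
qed

section \<open>From a double cover to a safe matching\<close>

text \<open>Here \<open>k\<close> labels arcs by faces. Carried over to ports, the label is constant
  along white and matching edges, whereas the ends of a red edge carry the labels of opposite
  arcs.\<close>

lemma safe_rotation_matching:
  fixes k :: "'a \<Rightarrow> 'a \<Rightarrow> 'b"
  assumes rot: "rotation \<sigma>"
    and face: "\<And>u v. u \<in> N v \<Longrightarrow> k v (\<sigma> v u) = k u v"
    and antisym: "\<And>u v. u \<in> N v \<Longrightarrow> k u v \<noteq> k v u"
  shows "safe_perfect_matching V E idx (rotation_matching \<sigma>)"
proof -
  let ?M = "rotation_matching \<sigma>"
  \<comment> \<open>Both \<open>out_port v u\<close> and \<open>in_port u v\<close> receive the
    label of the arc \<open>(v, u)\<close>. The description is unique because a port determines its
    arc.\<close>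
  define f where "f x = (THE n. \<exists>v u. u \<in> N v \<and>
    (x = out_port v u \<and> n = k v u \<or> x = in_port v u \<and> n = k u v))" for x
  have f_out: "f (out_port v u) = k v u" if "u \<in> N v" for v u
    unfolding f_def using that out_port_inj out_port_neq_in_port by (intro the_equality) blast+
  have f_in: "f (in_port v u) = k u v" if "u \<in> N v" for v u
    unfolding f_def using that in_port_inj out_port_neq_in_port
    by (intro the_equality) (blast, metis)
  have blue: "blue_perfect_matching V E idx ?M"
    by (rule blue_perfect_matching_rotation_matching[OF rot])
  have step: "f x = f y" if "{x, y} \<in> ?M \<union> white_edges V E idx" for x y
  proof -
    from that consider "{x, y} \<in> ?M" | "{x, y} \<in> white_edges V E idx" by blast
    then show ?thesis
    proof cases
      case 1
      then obtain v u where vu: "u \<in> N v" "{x, y} = {in_port v u, out_port v (\<sigma> v u)}"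
        unfolding rotation_matching_def by blast
      then have "f (in_port v u) = f (out_port v (\<sigma> v u))"
        using f_in f_out face rotation_N[OF rot] by simp
      then show ?thesis using vu(2) by (auto simp: doubleton_eq_iff)
    next
      case 2
      then obtain u v where uv: "v \<in> N u" "{x, y} = {out_port u v, in_port v u}"
        unfolding white_edges_ports in_N by blast
      then have "f (out_port u v) = f (in_port v u)"
        using f_in f_out N_sym by simp
      then show ?thesis using uv(2) by (auto simp: doubleton_eq_iff)
    qed
  qed
  have False if c: "is_cycle (?M \<union> white_edges V E idx) c" and r: "r \<in> red_edges V" "r \<subseteq> set c"
    for c r
  proof -
    obtain v u where vu: "u \<in> N v" "r = {out_port v u, in_port v u}"
      using r(1) unfolding red_edges_ports by blast
    have "f (out_port v u) = f (in_port v u)"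
      using constant_on_cycle[of _ f, OF step c] r(2) vu(2) by simp
    then show False
      using f_in f_out vu(1) antisym by metis
  qed
  then show ?thesis
    using blue sym_diff_blue_white[of ?M]
    unfolding safe_perfect_matching_def blue_perfect_matching_def by auto
qed

lemma dcdc_imp_safe:
  assumes dc: "directed_cycle_double_cover E cs"
  shows "\<exists>\<sigma>. safe_perfect_matching V E idx (rotation_matching \<sigma>)"
proof -
  \<comment> \<open>The label of an arc is the position of the member of the cover that contains
    it.\<close>
  define k where "k u v = (THE k. k < length cs \<and> (u, v) \<in> cycle_arcs (cs ! k))" for u v
  have k: "k u v < length cs" "(u, v) \<in> cycle_arcs (cs ! k u v)" if "u \<in> N v" for u v
    using theI'[OF dcdc_arc_unique[OF dc, of u v]] that unfolding k_def
    by (auto simp: in_N insert_commute)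
  have k_eq: "k u v = l" if "u \<in> N v" "l < length cs" "(u, v) \<in> cycle_arcs (cs ! l)" for u v l
    using the1_equality[OF dcdc_arc_unique[OF dc, of u v]] that unfolding k_def
    by (auto simp: in_N insert_commute)
  have cyc: "is_cycle E (cs ! l)" if "l < length cs" for l
    using dc that by (auto simp: directed_cycle_double_cover_def)
  have dist: "distinct (cs ! l)" if "l < length cs" for l
    using cyc[OF that] by (simp add: is_cycle_def)
  \<comment> \<open>The member entering \<open>v\<close> along \<open>(u, v)\<close> leaves
    \<open>v\<close> towards \<open>\<sigma> v u\<close>.\<close>
  define \<sigma> where "\<sigma> v u = (SOME w. (v, w) \<in> cycle_arcs (cs ! k u v) \<and> w \<noteq> u)" for v u
  have \<sigma>: "(v, \<sigma> v u) \<in> cycle_arcs (cs ! k u v)" "\<sigma> v u \<noteq> u" if "u \<in> N v" for u v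
    using someI_ex[OF is_cycle_succ[OF cyc[OF k(1)[OF that]] k(2)[OF that]]]
    unfolding \<sigma>_def by blast+
  have \<sigma>_N: "\<sigma> v u \<in> N v" if "u \<in> N v" for u v
    using cycle_arcs_edge[OF cyc[OF k(1)] \<sigma>(1)] that by (simp add: in_N)
  have face: "k v (\<sigma> v u) = k u v" if "u \<in> N v" for u v
    using k_eq[of v "\<sigma> v u"] \<sigma>_N[OF that] k(1)[OF that] \<sigma>(1)[OF that] N_sym by blast
  \<comment> \<open>A common outgoing arc forces a common member, in which \<open>v\<close> has only
    one predecessor.\<close>
  have "inj_on (\<sigma> v) (N v)" for v
  proof (rule inj_onI)
    fix u w assume uw: "u \<in> N v" "w \<in> N v" "\<sigma> v u = \<sigma> v w"
    then have "k u v = k w v" using face by metis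
    then show "u = w"
      using cycle_arcs_snd_unique[OF dist[OF k(1)[OF uw(1)]]] k(2) uw by metis
  qed
  then have "rotation \<sigma>"
    using \<sigma>(2) \<sigma>_N by (auto simp: rotation_def)
  moreover have "k u v \<noteq> k v u" if "u \<in> N v" for u v
    using is_cycle_arc_antisym[OF cyc[OF k(1)] k(2), OF that that] k(2)[of v u] that N_sym by metis
  ultimately have "safe_perfect_matching V E idx (rotation_matching \<sigma>)"
    using face by (intro safe_rotation_matching[where k = k]) blast+
  then show ?thesis by blast
qed

section \<open>From a safe matching to a double cover\<close>

text \<open>The edge of \<open>M\<close> at \<open>in_port v u\<close> ends in some
  \<open>out_port v w\<close> with \<open>w\<close> other than \<open>u\<close>, and
  \<open>w\<close> becomes the successor of \<open>u\<close>. Inclusion suffices below, since it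
  carries cycles over to the larger edge set.\<close>

lemma blue_perfect_matching_rotation:
  assumes M: "blue_perfect_matching V E idx M"
  obtains \<sigma> where "rotation \<sigma>" "rotation_matching \<sigma> \<subseteq> M"
proof -
  have blue: "M \<subseteq> blue_edges V" and ex1: "\<And>x. x \<in> hex_verts V \<Longrightarrow> \<exists>!e. e \<in> M \<and> x \<in> e"
    using M by (auto simp: blue_perfect_matching_def perfect_matching_def)
  have ports: "out_port v u \<in> hex_verts V" "in_port v u \<in> hex_verts V" if "u \<in> N v" for v u
    using that N_verts unfolding hex_verts_ports by blast+
  have ex: "\<exists>w. w \<in> N v \<and> w \<noteq> u \<and> {in_port v u, out_port v w} \<in> M" if u: "u \<in> N v" for v u
  proof -
    obtain e where e: "e \<in> M" "in_port v u \<in> e"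
      using ex1[OF ports(2)[OF u]] by blast
    then obtain v' u' w where e': "e = {in_port v' u', out_port v' w}" "u' \<in> N v'" "w \<in> N v'" "w \<noteq> u'"
      using blue unfolding blue_edges_ports by blast
    then have "in_port v u = in_port v' u'"
      using e(2) out_port_neq_in_port[symmetric] by auto
    then have "v = v'" "u = u'"
      using in_port_inj u e'(2) by blast+
    then show ?thesis
      using e e' by blast
  qed
  define \<sigma> where
    "\<sigma> v u = (SOME w. w \<in> N v \<and> w \<noteq> u \<and> {in_port v u, out_port v w} \<in> M)" for v u
  have \<sigma>: "\<sigma> v u \<in> N v" "\<sigma> v u \<noteq> u" "{in_port v u, out_port v (\<sigma> v u)} \<in> M"
    if "u \<in> N v" for v u
    using someI_ex[OF ex[OF that]] unfolding \<sigma>_def by blast+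
  \<comment> \<open>Only one edge of \<open>M\<close> covers the shared out port, so the in ports
    agree as well.\<close>
  have "inj_on (\<sigma> v) (N v)" for v
  proof (rule inj_onI)
    fix u w assume uw: "u \<in> N v" "w \<in> N v" "\<sigma> v u = \<sigma> v w"
    then have "{in_port v u, out_port v (\<sigma> v u)} = {in_port v w, out_port v (\<sigma> v w)}"
      using ex1[OF ports(1)[OF \<sigma>(1)[OF uw(1)]]] \<sigma>(3) by (metis insertCI)
    then have "in_port v u = in_port v w"
      using out_port_neq_in_port by (metis doubleton_eq_iff)
    then show "u = w"
      using in_port_inj uw by blast
  qed
  then have "rotation \<sigma>"
    using \<sigma>(1,2) by (auto simp: rotation_def)
  moreover have "rotation_matching \<sigma> \<subseteq> M"
    using \<sigma>(3) unfolding rotation_matching_def by blast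
  ultimately show thesis using that by blast
qed

definition darts :: "('a \<times> 'a) set" where
  "darts = {(u, v). {u, v} \<in> E}"

lemma darts_iff: "(u, v) \<in> darts \<longleftrightarrow> u \<in> N v"
  by (simp add: darts_def in_N insert_commute)

lemma finite_darts: "finite darts"
proof (rule finite_subset)
  show "darts \<subseteq> V \<times> V"
    using edge_verts by (auto simp: darts_def)
  show "finite (V \<times> V)"
    using cubic by (simp add: finite_simple_cubic_graph_def)
qed

text \<open>The orbits of darts are the facial walks. Being the identity elsewhere makes this a
  permutation of the whole type.\<close>

definition face_perm :: "('a \<Rightarrow> 'a \<Rightarrow> 'a) \<Rightarrow> 'a \<times> 'a \<Rightarrow> 'a \<times> 'a" where
  "face_perm \<sigma> d = (if d \<in> darts then (snd d, \<sigma> (snd d) (fst d)) else d)"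

lemma face_perm_dart: "u \<in> N v \<Longrightarrow> face_perm \<sigma> (u, v) = (v, \<sigma> v u)"
  by (simp add: face_perm_def darts_iff)

lemma face_perm_permutes:
  assumes "rotation \<sigma>"
  shows "face_perm \<sigma> permutes darts"
proof (rule inj_imp_permutes)
  show "inj_on (face_perm \<sigma>) darts"
    using rotation_inj[OF assms]
    by (intro inj_onI) (auto simp: darts_iff face_perm_dart)
  show "face_perm \<sigma> d \<in> darts" if "d \<in> darts" for d
    using that rotation_N[OF assms] N_sym by (cases d) (auto simp: darts_iff face_perm_dart)
qed (auto simp: finite_darts face_perm_def)

lemma permutation_face_perm: "rotation \<sigma> \<Longrightarrow> permutation (face_perm \<sigma>)"
  using face_perm_permutes finite_darts permutation_permutes by blast

lemma face_subset_darts: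
  assumes "rotation \<sigma>" "d \<in> darts"
  shows "set (support (face_perm \<sigma>) d) \<subseteq> darts"
proof -
  have "(face_perm \<sigma> ^^ i) d \<in> darts" for i
    using assms(2) permutes_in_image[OF permutes_funpow[OF face_perm_permutes[OF assms(1)]]]
    by blast
  then show ?thesis by auto
qed

text \<open>A face, read as a closed walk in the hexagon graph, alternates between white edges and
  edges of the matching.\<close>

lemma face_port_cycle:
  assumes rot: "rotation \<sigma>" and d: "d \<in> darts"
  defines "ds \<equiv> support (face_perm \<sigma>) d"
  obtains c where "is_cycle (rotation_matching \<sigma> \<union> white_edges V E idx) c"
    "\<And>u v. (u, v) \<in> set ds \<Longrightarrow> out_port u v \<in> set c \<and> in_port v u \<in> set c"
proof -
  let ?F = "face_perm \<sigma>" and ?n = "length ds"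
  have perm: "permutation ?F" by (rule permutation_face_perm[OF rot])
  have sub: "set ds \<subseteq> darts"
    unfolding ds_def by (rule face_subset_darts[OF rot d])
  have dist: "distinct ds"
    unfolding ds_def by (rule cycle_of_permutation[OF perm])
  obtain u0 v0 where uv0: "d = (u0, v0)" "u0 \<in> N v0"
    using d by (cases d) (auto simp: darts_iff)
  \<comment> \<open>A dart has distinct ends, so its face has at least two darts and the port walk
    at least four vertices.\<close>
  have "?F d \<noteq> d"
    using uv0 N_verts by (auto simp: face_perm_dart)
  then have n: "?n > 1"
    using least_power_gt_one[OF perm] by (simp add: ds_def)
  then have "ds \<noteq> []" by auto
  have nth: "snd (ds ! k) \<in> N (fst (ds ! k))" "fst (ds ! k) \<in> N (snd (ds ! k))" if "k < ?n" for k
    using sub nth_mem[OF that] N_sym by (cases "ds ! k"; auto simp: darts_iff)+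
  have succ: "ds ! (Suc k mod ?n) = (snd (ds ! k), \<sigma> (snd (ds ! k)) (fst (ds ! k)))" if "k < ?n" for k
  proof -
    have "(ds ! k, ds ! (Suc k mod ?n)) \<in> cycle_arcs ds"
      using that unfolding cycle_arcs_def by blast
    then have "ds ! (Suc k mod ?n) = ?F (ds ! k)"
      using cycle_arcs_support[OF perm, of d] by (auto simp: ds_def simp del: set_map)
    then show ?thesis
      using face_perm_dart[OF nth(2)[OF that]] by simp
  qed
  \<comment> \<open>Position \<open>2 * k\<close> holds the out port of the \<open>k\<close>-th
    dart, the next position its in port.\<close>
  define g where "g i = (let x = ds ! (i div 2) in
    if even i then out_port (fst x) (snd x) else in_port (snd x) (fst x))" for i
  let ?c = "map g [0..<2 * ?n]"
  have "inj_on g {0..<2 * ?n}"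
  proof (rule inj_onI)
    fix i j assume ij: "i \<in> {0..<2 * ?n}" "j \<in> {0..<2 * ?n}" "g i = g j"
    then have lt: "i div 2 < ?n" "j div 2 < ?n" by auto
    have par: "even i \<longleftrightarrow> even j"
      using ij(3) out_port_neq_in_port out_port_neq_in_port[symmetric]
      by (auto simp: g_def Let_def split: if_splits)
    have "ds ! (i div 2) = ds ! (j div 2)"
    proof (cases "even i")
      case True
      then show ?thesis
        using ij(3) par out_port_inj[OF nth(1)[OF lt(1)] nth(1)[OF lt(2)]]
        by (auto simp: g_def Let_def prod_eq_iff)
    next
      case False
      then show ?thesis
        using ij(3) par in_port_inj[OF nth(2)[OF lt(1)] nth(2)[OF lt(2)]]
        by (auto simp: g_def Let_def prod_eq_iff)
    qed
    then have "i div 2 = j div 2"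
      using dist lt by (simp add: nth_eq_iff_index_eq)
    then show "i = j"
      using par by (metis even_iff_mod_2_eq_zero mod_div_mult_eq odd_iff_mod_2_eq_one)
  qed
  then have "distinct ?c" by (simp add: distinct_map)
  moreover have edge: "{g i, g (Suc i mod (2 * ?n))} \<in> rotation_matching \<sigma> \<union> white_edges V E idx"
    if i: "i < 2 * ?n" for i
  proof (cases "even i")
    case True
    then obtain k where k: "i = 2 * k" by (elim evenE)
    then have "Suc i < 2 * ?n" "k < ?n" using i by auto
    then have "{g i, g (Suc i mod (2 * ?n))} =
        {out_port (fst (ds ! k)) (snd (ds ! k)), in_port (snd (ds ! k)) (fst (ds ! k))}"
      using k by (simp add: g_def Let_def)
    then show ?thesis
      using nth(1)[OF \<open>k < ?n\<close>] unfolding white_edges_ports in_N by blast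
  next
    case False
    then obtain k where k: "i = 2 * k + 1" by (elim oddE)
    then have lt: "k < ?n" using i by auto
    \<comment> \<open>As \<open>Suc i\<close> is \<open>2 * (k + 1)\<close>, reduction modulo
      \<open>2 * ?n\<close> closes the port walk exactly where the face closes.\<close>
    have "Suc i mod (2 * ?n) = 2 * (Suc k mod ?n)"
      using k by (simp add: mult_mod_right)
    then have "g (Suc i mod (2 * ?n)) = out_port (snd (ds ! k)) (\<sigma> (snd (ds ! k)) (fst (ds ! k)))"
      using succ[OF lt] by (simp add: g_def Let_def)
    moreover have "g i = in_port (snd (ds ! k)) (fst (ds ! k))"
      using k by (simp add: g_def Let_def)
    ultimately show ?thesis
      using nth(2)[OF lt] unfolding rotation_matching_def by auto
  qed
  have "cycle_arcs ?c = (\<lambda>i. (g i, g (Suc i mod (2 * ?n)))) ` {..<2 * ?n}"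
    using \<open>ds \<noteq> []\<close> by (simp add: cycle_arcs_image)
  then have "cycle_edges ?c = (\<lambda>i. {g i, g (Suc i mod (2 * ?n))}) ` {..<2 * ?n}"
    by (simp add: cycle_edges_image image_image)
  then have "cycle_edges ?c \<subseteq> rotation_matching \<sigma> \<union> white_edges V E idx"
    using edge by (simp only: image_subset_iff lessThan_iff) simp
  ultimately have "is_cycle (rotation_matching \<sigma> \<union> white_edges V E idx) ?c"
    using n by (simp add: is_cycle_def)
  moreover have "out_port u v \<in> set ?c \<and> in_port v u \<in> set ?c" if uv: "(u, v) \<in> set ds" for u v
  proof -
    obtain k where k: "k < ?n" "ds ! k = (u, v)"
      using uv by (auto simp: in_set_conv_nth)
    have "out_port u v = g (2 * k)" "in_port v u = g (Suc (2 * k))"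
      using k by (simp_all add: g_def Let_def)
    moreover have "2 * k \<in> {0..<2 * ?n}" "Suc (2 * k) \<in> {0..<2 * ?n}"
      using k by auto
    ultimately show ?thesis
      by (metis imageI set_map set_upt)
  qed
  ultimately show thesis using that by blast
qed

text \<open>Safety forbids opposite darts in one face; degree three then forbids two darts with the
  same tail, so the list of tails is a cycle.\<close>

lemma face_cycle:
  assumes rot: "rotation \<sigma>" and safe: "safe_perfect_matching V E idx M"
    and M: "rotation_matching \<sigma> \<subseteq> M" and d: "d \<in> darts"
  defines "ds \<equiv> support (face_perm \<sigma>) d"
  shows "is_cycle E (map fst ds) \<and> cycle_arcs (map fst ds) = set ds"
proof -
  let ?F = "face_perm \<sigma>"
  have perm: "permutation ?F" by (rule permutation_face_perm[OF rot])
  have sub: "set ds \<subseteq> darts"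
    unfolding ds_def by (rule face_subset_darts[OF rot d])
  have arcs: "cycle_arcs ds = (\<lambda>y. (y, ?F y)) ` set ds"
    unfolding ds_def by (rule cycle_arcs_support[OF perm])
  \<comment> \<open>Opposite darts would put \<open>out_port u v\<close> and
    \<open>in_port u v\<close>, the ends of a red edge, on one cycle.\<close>
  have no_rev: "(v, u) \<notin> set ds" if uv: "(u, v) \<in> set ds" for u v
  proof
    assume vu: "(v, u) \<in> set ds"
    obtain c where c: "is_cycle (rotation_matching \<sigma> \<union> white_edges V E idx) c"
      "\<And>u v. (u, v) \<in> set ds \<Longrightarrow> out_port u v \<in> set c \<and> in_port v u \<in> set c"
      using face_port_cycle[OF rot d] unfolding ds_def by blast
    have "is_cycle (sym_diff M (white_edges V E idx)) c"
      using c(1) M safe sym_diff_blue_white[of M]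
      unfolding is_cycle_def safe_perfect_matching_def blue_perfect_matching_def by blast
    moreover have "v \<in> N u"
      using uv sub darts_iff N_sym by blast
    then have "{out_port u v, in_port u v} \<in> red_edges V"
      unfolding red_edges_ports by blast
    moreover have "{out_port u v, in_port u v} \<subseteq> set c"
      using c(2)[OF uv] c(2)[OF vu] by simp
    ultimately show False
      using safe unfolding safe_perfect_matching_def by blast
  qed
  have closed: "?F y \<in> set ds" if "y \<in> set ds" for y
    using cycle_arcs_set(2)[of y "?F y" ds] that arcs by blast
  have inj: "inj ?F"
    using perm by (simp add: permutation bij_is_inj)
  have onto: "?F ` set ds = set ds"
    using closed inj by (intro endo_inj_surj) (auto intro: inj_on_subset)
  have pred: "y \<in> set ds" if "?F y \<in> set ds" for y
    using that onto inj by (metis image_iff inj_eq)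
  \<comment> \<open>The dart preceding \<open>(v, b)\<close> would be \<open>(a, v)\<close>, the
    reverse of \<open>(v, a)\<close>.\<close>
  have False if "(v, a) \<in> set ds" "(v, b) \<in> set ds" "a \<in> N v" "b \<in> N v" "\<sigma> v a = b" for v a b
    using pred[of "(a, v)"] no_rev[of v a] that by (simp add: face_perm_dart)
  then have "a = b" if "(v, a) \<in> set ds" "(v, b) \<in> set ds" for v a b
    using rotation_adjacent[OF rot, of a v b] sub N_sym that darts_iff by (metis subsetD)
  then have "inj_on fst (set ds)"
    by (auto intro!: inj_onI)
  moreover have "distinct ds"
    unfolding ds_def by (rule cycle_of_permutation[OF perm])
  ultimately have dist: "distinct (map fst ds)"
    by (simp add: distinct_map)
  have "cycle_arcs (map fst ds) = (\<lambda>y. (fst y, fst (?F y))) ` set ds"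
    by (simp add: cycle_arcs_map arcs image_image)
  \<comment> \<open>The tail of the next dart is the head of the present one, so the arcs of the
    tail list are the darts themselves.\<close>
  also have "\<dots> = (\<lambda>y. y) ` set ds"
    using sub by (intro image_cong) (auto simp: face_perm_def)
  finally have fst_arcs: "cycle_arcs (map fst ds) = set ds"
    by simp
  have "3 \<le> length ds"
  proof -
    obtain u v where uv: "d = (u, v)" "u \<in> N v"
      using d by (cases d) (auto simp: darts_iff)
    let ?w = "\<sigma> v u"
    have w: "?w \<in> N v" "?w \<noteq> u"
      using rotation_N[OF rot] rotation_neq[OF rot] uv(2) by blast+
    have "d \<in> set ds"
      using least_power_of_permutation(2)[OF perm, of d] by (force simp: ds_def)
    \<comment> \<open>Three consecutive darts of the face have the tails \<open>u\<close>,
      \<open>v\<close> and \<open>?w\<close>, which are pairwise distinct.\<close>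
    then have "{u, v, ?w} \<subseteq> fst ` set ds"
      using closed[of d] closed[of "?F d"] closed[of "(v, ?w)"] uv w N_sym[of ?w v]
      by (force simp: face_perm_dart)
    then have "card {u, v, ?w} \<le> card (set (map fst ds))"
      by (intro card_mono) auto
    also have "\<dots> \<le> length ds"
      using card_length[of "map fst ds"] by simp
    finally show ?thesis
      using w N_verts[OF w(1)] N_verts[OF uv(2)] by auto
  qed
  then have "is_cycle E (map fst ds)"
    using dist fst_arcs sub by (auto simp: is_cycle_def cycle_edges_def darts_def)
  then show ?thesis
    using fst_arcs by blast
qed

text \<open>The faces, as orbits of a permutation, partition the darts, and each is the arc set of a
  cycle.\<close>

lemma safe_imp_dcdc:
  assumes safe: "safe_perfect_matching V E idx M"
  shows "\<exists>cs. directed_cycle_double_cover E cs"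
proof -
  obtain \<sigma> where rot: "rotation \<sigma>" and M: "rotation_matching \<sigma> \<subseteq> M"
    using blue_perfect_matching_rotation safe unfolding safe_perfect_matching_def by blast
  let ?face = "\<lambda>d. set (support (face_perm \<sigma>) d)"
  have perm: "permutation (face_perm \<sigma>)" by (rule permutation_face_perm[OF rot])
  show ?thesis
  proof (rule dcdc_from_arc_partition)
    show "simple_graph V E"
      using cubic by (simp add: finite_simple_cubic_graph_def)
    show "finite (?face ` darts)"
      using finite_darts by simp
    show "disjoint (?face ` darts)"
      using disjoint_support[OF perm] unfolding disjoint_def by blast
    have "d \<in> ?face d" for d
      using least_power_of_permutation(2)[OF perm, of d] by force
    then have "\<Union>(?face ` darts) = darts"
      using face_subset_darts[OF rot] by blast
    then show "\<Union>(?face ` darts) = {(u, v). {u, v} \<in> E}"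
      by (simp add: darts_def)
    show "\<exists>c. is_cycle E c \<and> cycle_arcs c = A" if "A \<in> ?face ` darts" for A
      using that face_cycle[OF rot safe M] by blast
  qed
qed

end

theorem corollary4:
  fixes V :: "'a set" and E :: "'a set set" and idx :: "'a \<Rightarrow> 'a \<Rightarrow> nat"
  assumes "finite_simple_cubic_graph V E"
    and "hexagon_indexing V E idx"
  shows "(\<exists>cs. directed_cycle_double_cover E cs) \<longleftrightarrow> (\<exists>M. safe_perfect_matching V E idx M)"
proof -
  interpret indexed_cubic_graph V E idx
    using assms by unfold_locales
  show ?thesis
    using dcdc_imp_safe safe_imp_dcdc by blast
qed

end
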